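(* (I) (Observable restriction implies cone-pair.) Let $V$ be a finite-dimensional real vector space, let $C\subset V$ be a cone, let $\lambda\in V^*$ separate $C$ from $-C$, and let $W^*$ be a linear subspace of $V^*$ containing $\lambda$. Put $W:=(W^* )^*$. For $\eta\in V$, regarded as a linear functional on $V^*$ via $\eta[x]=x[\eta]$, let $\eta{\downharpoonright}\in W$ denote the restriction of $\eta$ to $W^*$. Define $D:=\{\eta{\downharpoonright}:\eta\in C\}\subset W$ and $\pi:V\to W$, $\pi(\eta):=\eta{\downharpoonright}$, and let $\tilde\lambda:=\lambda$, regarded as a linear functional on $W$ by $\tilde\lambda[y]=y[\lambda]$ for $y\in W$. Then $V,W,C,D,\lambda,\tilde\lambda,\pi$ form a cone-pair. That is, $D$ is a cone in $W$, $\pi(C)=D$, and $\pi$ maps the plane $L_\lambda=\{\eta\in V:\lambda[\eta]=1\}$ onto $M_\lambda=\{y\in W:\tilde\lambda[y]=1\}$, which is a translate of a plane separating $D$ from $-D$ (namely of the kernel of $\tilde\lambda$, where $\tilde\lambda$ separates $D$ from $-D$). (II) (Cone-pair implies observable restriction.) Let $V,W,C,D,\lambda,\tilde\lambda,\pi$ be a cone-pair. Then there exists an injection $\tau:W^*\to V^*$ with $\tau(\tilde\lambda)=\lambda$ such that $\pi$ is the map from $V$ to $W$ that takes $x$ to $x{\downharpoonright}_{W^*}$, where $x{\downharpoonright}_{W^*}$ is the linear functional on $W^*$ (i.e. the element of $W\cong (W^* )^*$) whose value on $a\in W^*$ is the value at $\tau(a)$ of the restriction of $x$ (viewed as a functional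 on $V^*$) to $\tau(W^* )$; i.e. $\pi(x)[a]=x[\tau(a)]$ for all $x\in V$, $a\in W^*$.
   Context: All vector spaces are finite-dimensional and real. A "cone" means a regular cone: a proper subset $K$ of a vector space $V$ that is closed under multiplication by nonnegative scalars, convex, generating ($K-K=V$), pointed ($K\cap -K=\{0\}$) and topologically closed. $V^*$ is the space of linear functionals on $V$; for $\alpha\in V^*$, $x\in V$ the value is written $\alpha[x]$ (or $\alpha(x)$), and $V$ is identified with $(V^* )^*$ via $x[\alpha]=\alpha[x]$. The dual cone of $C\subset V$ is $C^*=\{\alpha\in V^*:\alpha[x]\ge 0\ \forall x\in C\}$. A functional $\lambda\in V^*$ separates $C$ from $-C$ if $\lambda[x]>0$ for all nonzero $x\in C$. A cone-pair consists of finite-dimensional real vector spaces $V,W$ with cones $C\subset V$, $D\subset W$, functionals $\lambda\in C^*$, $\tilde\lambda\in D^*$ that separate $C$ from $-C$ and $D$ from $-D$ respectively, and a linear map $\pi:V\to W$ such that $\pi(C)=D$ and $\pi$ maps the affine plane $L_\lambda=\{x\in V:\lambda[x]=1\}$ onto the affine plane $M_{\tilde\lambda}=\{y\in W:\tilde\lambda[y]=1\}$. *)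

theory Defs
  imports "HOL-Analysis.Analysis" "HOL-Library.Function_Algebras"
begin

text \<open>Pointwise scalar multiplication, so that spaces of functionals are real vector spaces.\<close>

instantiation "fun" :: (type, real_vector) real_vector
begin

definition scaleR_fun :: "real \<Rightarrow> ('a \<Rightarrow> 'b) \<Rightarrow> 'a \<Rightarrow> 'b" where
  "scaleR_fun c f = (\<lambda>x. c *\<^sub>R f x)"

instance
  by standard (auto simp: scaleR_fun_def fun_eq_iff algebra_simps)

end

lemma scaleR_fun_apply [simp]: "(c *\<^sub>R f) x = c *\<^sub>R f x"
  by (simp add: scaleR_fun_def)

text \<open>
  A finite-dimensional real vector space is a finite-dimensional linear subspace of some type of
  class \<open>real_vector\<close>. Carriers are sets rather than types because the construction of the dual
  of a subspace of a dual space has to stay within the same notion of vector space.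
\<close>

definition fin_dim_space :: "'a::real_vector set \<Rightarrow> bool" where
  "fin_dim_space V \<longleftrightarrow> subspace V \<and> (\<exists>B. finite B \<and> span B = V)"

definition linear_on :: "'a::real_vector set \<Rightarrow> ('a \<Rightarrow> 'b::real_vector) \<Rightarrow> bool" where
  "linear_on V f \<longleftrightarrow>
     (\<forall>x\<in>V. \<forall>y\<in>V. f (x + y) = f x + f y) \<and> (\<forall>c. \<forall>x\<in>V. f (c *\<^sub>R x) = c *\<^sub>R f x)"

text \<open>
  A functional on \<open>V\<close> is represented by a total function with the value 0 outside \<open>V\<close>. Distinct
  functions in \<open>dual V\<close> then are distinct functionals on \<open>V\<close>, and \<open>dual V\<close> is closed under the
  pointwise operations (which it would not be under the convention of \<open>extensional\<close>).
\<close>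

definition restr :: "'a set \<Rightarrow> ('a \<Rightarrow> real) \<Rightarrow> 'a \<Rightarrow> real" where
  "restr S f = (\<lambda>x. if x \<in> S then f x else 0)"

definition dual :: "'a::real_vector set \<Rightarrow> ('a \<Rightarrow> real) set" where
  "dual V = {\<alpha>. linear_on V \<alpha> \<and> (\<forall>x. x \<notin> V \<longrightarrow> \<alpha> x = 0)}"

text \<open>The identification of \<open>x \<in> V\<close> with the functional \<open>\<alpha> \<mapsto> \<alpha>[x]\<close> in \<open>dual (dual V)\<close>.\<close>

definition ev :: "'a::real_vector set \<Rightarrow> 'a \<Rightarrow> ('a \<Rightarrow> real) \<Rightarrow> real" where
  "ev V x = restr (dual V) (\<lambda>\<alpha>. \<alpha> x)"

text \<open>
  The usual topology of a finite-dimensional space \<open>V\<close>, given without a choice of norm or basis: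
  the coarsest one making all linear functionals continuous. The lemma
  \<open>fin_dim_topology_euclidean\<close> below compares it with the topology of a Euclidean space.
\<close>

definition fin_dim_topology :: "'a::real_vector set \<Rightarrow> 'a topology" where
  "fin_dim_topology V =
     topology_generated_by {{x \<in> V. \<alpha> x \<in> U} | \<alpha> U. \<alpha> \<in> dual V \<and> open U}"

definition regular_cone :: "'a::real_vector set \<Rightarrow> 'a set \<Rightarrow> bool" where
  "regular_cone V K \<longleftrightarrow>
     K \<subset> V \<and> cone K \<and> convex K \<and>
     {x - y | x y. x \<in> K \<and> y \<in> K} = V \<and>
     K \<inter> uminus ` K = {0} \<and>
     closedin (fin_dim_topology V) K"

definition dual_cone :: "'a::real_vector set \<Rightarrow> 'a set \<Rightarrow> ('a \<Rightarrow> real) set" where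
  "dual_cone V C = {\<alpha> \<in> dual V. \<forall>x\<in>C. \<alpha> x \<ge> 0}"

text \<open>The functional \<open>\<alpha>\<close> separates \<open>C\<close> from \<open>-C\<close>.\<close>

definition separates :: "'a::real_vector set \<Rightarrow> ('a \<Rightarrow> real) \<Rightarrow> bool" where
  "separates C \<alpha> \<longleftrightarrow> (\<forall>x\<in>C. x \<noteq> 0 \<longrightarrow> \<alpha> x > 0)"

definition unit_plane :: "'a::real_vector set \<Rightarrow> ('a \<Rightarrow> real) \<Rightarrow> 'a set" where
  "unit_plane V \<alpha> = {x \<in> V. \<alpha> x = 1}"

definition cone_pair ::
  "'v::real_vector set \<Rightarrow> 'w::real_vector set \<Rightarrow> 'v set \<Rightarrow> 'w set \<Rightarrow>
   ('v \<Rightarrow> real) \<Rightarrow> ('w \<Rightarrow> real) \<Rightarrow> ('v \<Rightarrow> 'w) \<Rightarrow> bool" where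
  "cone_pair V W C D lam lam' \<pi> \<longleftrightarrow>
     fin_dim_space V \<and> fin_dim_space W \<and>
     regular_cone V C \<and> regular_cone W D \<and>
     lam \<in> dual_cone V C \<and> lam' \<in> dual_cone W D \<and>
     separates C lam \<and> separates D lam' \<and>
     \<pi> \<in> V \<rightarrow> W \<and> linear_on V \<pi> \<and>
     \<pi> ` C = D \<and> \<pi> ` unit_plane V lam = unit_plane W lam'"

lemma fin_dim_topology_euclidean:
  fixes V :: "'a::euclidean_space set"
  assumes V: "subspace V"
  shows "fin_dim_topology V = top_of_set V"
proof (rule topology_eq[THEN iffD2], intro allI iffI)
  let ?G = "{{x \<in> V. \<alpha> x \<in> U} | \<alpha> U. \<alpha> \<in> dual V \<and> open U}"
  have inner_dual: "restr V (\<lambda>x. x \<bullet> b) \<in> dual V" for b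
    using V by (auto simp: dual_def linear_on_def restr_def inner_add_left subspace_add subspace_scale)
  have cont: "continuous_on V \<alpha>" if "\<alpha> \<in> dual V" for \<alpha>
  proof -
    have "\<exists>g :: 'a \<Rightarrow> real. linear g \<and> (\<forall>x\<in>V. g x = \<alpha> x)"
    proof -
      obtain B where B: "B \<subseteq> V" "independent B" "V = span B"
        using V by (metis basis_exists span_subspace)
      obtain g where g: "linear g" "\<And>x. x \<in> B \<Longrightarrow> g x = \<alpha> x"
        using linear_independent_extend[OF B(2), of \<alpha>] by blast
      have "g x = \<alpha> x" if "x \<in> V" for x
      proof -
        have "x \<in> span B" using that B by simp
        then have "x \<in> V \<and> g x = \<alpha> x"
        proof (induction rule: span_induct_alt)
          case base
          have "\<alpha> (0 *\<^sub>R 0) = 0 *\<^sub>R \<alpha> 0"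
            using \<open>\<alpha> \<in> dual V\<close> V unfolding dual_def linear_on_def by (blast intro: subspace_0)
          then show ?case using V linear_0[OF g(1)] by (simp add: subspace_0)
        next
          case (step c x y)
          have xV: "x \<in> V" using B step by auto
          have "\<alpha> (c *\<^sub>R x + y) = c *\<^sub>R \<alpha> x + \<alpha> y"
            using \<open>\<alpha> \<in> dual V\<close> xV step V
            unfolding dual_def linear_on_def by (simp add: subspace_scale)
          then show ?case
            using step g xV V by (simp add: linear_add linear_cmul subspace_add subspace_scale)
        qed
        then show ?thesis by simp
      qed
      then show ?thesis using g by auto
    qed
    then obtain g where g: "linear g" "\<forall>x\<in>V. g x = \<alpha> x" by blast
    have "continuous_on V g" using g(1) by (simp add: linear_continuous_on linear_conv_bounded_linear)
    then show ?thesis using g(2) continuous_on_cong by fastforce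
  qed
  fix S
  show "openin (top_of_set V) S" if "openin (fin_dim_topology V) S"
  proof -
    have "generate_topology_on ?G S"
      using that by (simp add: fin_dim_topology_def openin_topology_generated_by_iff)
    then show ?thesis
    proof induction
      case (Basis s)
      then obtain \<alpha> U where s: "s = {x \<in> V. \<alpha> x \<in> U}" and "\<alpha> \<in> dual V" "open U" by auto
      moreover have "{x \<in> V. \<alpha> x \<in> U} = V \<inter> \<alpha> -` U" by auto
      ultimately show ?case
        using continuous_openin_preimage_gen[OF cont] by metis
    next
      case (UN K)
      then show ?case by (blast intro: openin_Union)
    next
      case (Int a b)
      then show ?case by (blast intro: openin_Int)
    next
      case Empty
      then show ?case by simp
    qed
  qed
  show "openin (fin_dim_topology V) S" if "openin (top_of_set V) S"
  proof -
    obtain T where T: "open T" "S = V \<inter> T" using \<open>openin (top_of_set V) S\<close> by (auto simp: openin_open)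
    have "\<exists>N. openin (fin_dim_topology V) N \<and> x \<in> N \<and> N \<subseteq> S" if "x \<in> S" for x
    proof -
      have "x \<in> T" "x \<in> V" using that T by auto
      obtain a b where ab: "x \<in> box a b" "box a b \<subseteq> T"
        using open_contains_box[OF T(1) \<open>x \<in> T\<close>] by metis
      let ?f = "\<lambda>i. {y \<in> V. restr V (\<lambda>x. x \<bullet> i) y \<in> {a \<bullet> i<..<b \<bullet> i}}"
      let ?N = "\<Inter>i\<in>Basis. ?f i"
      have "openin (fin_dim_topology V) (?f i)" for i
        unfolding fin_dim_topology_def
        by (rule topology_generated_by_Basis) (use inner_dual open_greaterThanLessThan in blast)
      then have "openin (fin_dim_topology V) ?N"
        by (intro openin_INT2 finite_Basis nonempty_Basis)
      moreover have "?N = V \<inter> box a b"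
      proof (intro equalityI subsetI)
        fix y assume y: "y \<in> ?N"
        obtain i :: 'a where "i \<in> Basis" using nonempty_Basis by blast
        then have "y \<in> V" using y by auto
        then show "y \<in> V \<inter> box a b" using y by (auto simp: restr_def mem_box)
      qed (auto simp: restr_def mem_box)
      ultimately show ?thesis
        using T ab \<open>x \<in> V\<close> by (intro exI[of _ ?N]) auto
    qed
    then show ?thesis by (subst openin_subopen) auto
  qed
qed

end

theory Submission
  imports Defs
begin

text \<open>
  The only analytic point of part (I) is that \<open>D = \<pi>(C)\<close> is closed. Since \<open>\<lambda>\<close> is positive on the
  compact unit sphere of \<open>C\<close>, the truncations \<open>{x \<in> C. \<lambda>[x] \<le> r}\<close> are compact; as \<open>\<lambda>\<close> factors
  through \<open>\<pi>\<close>, their images are exactly the truncations of \<open>D\<close>, so \<open>D\<close> is closed near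
  every point. Surjectivity of \<open>\<pi>\<close> is biduality: extend a functional on \<open>W\<^sup>*\<close> to \<open>V\<^sup>*\<close> and
  represent it by a point of \<open>V\<close>. In part (II), \<open>\<tau>\<close> is the transpose of \<open>\<pi>\<close>.
\<close>

section \<open>Linear functionals on finite-dimensional subspaces\<close>

lemma linear_on_0:
  assumes "linear_on V f" "subspace V"
  shows "f 0 = 0"
proof -
  have "f (0 *\<^sub>R 0) = 0 *\<^sub>R f 0"
    using assms unfolding linear_on_def by (blast intro: subspace_0)
  then show ?thesis by simp
qed

lemma linear_on_diff:
  assumes "linear_on V f" "subspace V" "x \<in> V" "y \<in> V"
  shows "f (x - y) = f x - f y"
proof -
  have "f (x + (-1) *\<^sub>R y) = f x + (-1) *\<^sub>R f y"
    using assms unfolding linear_on_def by (metis subspace_scale)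
  then show ?thesis by simp
qed

lemma linear_on_sum:
  assumes "linear_on V f" "subspace V" "finite A" "\<And>a. a \<in> A \<Longrightarrow> u a \<in> V"
  shows "f (\<Sum>a\<in>A. c a *\<^sub>R u a) = (\<Sum>a\<in>A. c a *\<^sub>R f (u a))"
  using assms(3,4)
proof (induction A rule: finite_induct)
  case empty
  then show ?case using linear_on_0[OF assms(1,2)] by simp
next
  case (insert a A)
  have "(\<Sum>a\<in>A. c a *\<^sub>R u a) \<in> V" "c a *\<^sub>R u a \<in> V"
    using insert assms(2) by (auto intro!: subspace_sum subspace_scale)
  then have "f (c a *\<^sub>R u a + (\<Sum>a\<in>A. c a *\<^sub>R u a)) = c a *\<^sub>R f (u a) + f (\<Sum>a\<in>A. c a *\<^sub>R u a)"
    using assms(1) insert.prems by (simp add: linear_on_def)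
  then show ?case using insert by simp
qed

text \<open>Gives a map that is linear on the whole ambient type, so that it can be applied beyond
  \<open>V\<close>. Biduality needs this to evaluate a functional given on a subspace of the dual at
  the coordinate functionals, which may lie outside that subspace.\<close>

lemma linear_on_extend:
  assumes "subspace V" "linear_on V f"
  obtains g where "linear g" "\<And>x. x \<in> V \<Longrightarrow> g x = f x"
proof -
  obtain B where B: "B \<subseteq> V" "independent B" "V = span B"
    using assms(1) by (metis basis_exists span_subspace)
  obtain g where g: "linear g" "\<And>x. x \<in> B \<Longrightarrow> g x = f x"
    using linear_independent_extend[OF B(2), of f] by blast
  have "g x = f x" if "x \<in> V" for x
  proof -
    have "x \<in> span B" using that B by simp
    \<comment> \<open>Membership in \<open>V\<close> is carried through the induction because
      \<open>f\<close> is additive and homogeneous only there.\<close>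
    then have "x \<in> V \<and> g x = f x"
    proof (induction rule: span_induct_alt)
      case base
      then show ?case
        using linear_0[OF g(1)] linear_on_0[OF assms(2,1)] subspace_0[OF assms(1)] by simp
    next
      case (step c x y)
      have "x \<in> V" using B step by auto
      then show ?case
        using step g assms unfolding linear_on_def
        by (simp add: linear_add linear_cmul subspace_add subspace_scale)
    qed
    then show ?thesis by simp
  qed
  then show thesis using g that by blast
qed

lemma fin_dim_space_subspace:
  assumes "fin_dim_space V" "subspace S" "S \<subseteq> V"
  shows "fin_dim_space S"
proof -
  obtain A where A: "finite A" "span A = V"
    using assms(1) by (auto simp: fin_dim_space_def)
  obtain B where B: "B \<subseteq> S" "independent B" "S = span B"
    using assms(2) by (metis basis_exists span_subspace)
  have "finite B"
    using independent_span_bound[OF A(1) B(2)] B(1) A(2) assms(3) by auto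
  then show ?thesis using assms(2) B by (auto simp: fin_dim_space_def)
qed

text \<open>The \<kappa> b are the coordinate functionals of a basis \<open>B\<close>: each extends
  the Kronecker delta at \<open>b\<close> from \<open>B\<close> to a linear functional on the
  ambient type. The expansion holds on \<open>B\<close>, hence on its span.\<close>

lemma fin_dim_space_coordinates:
  assumes "fin_dim_space V"
  obtains B and \<kappa> :: "'a::real_vector \<Rightarrow> 'a \<Rightarrow> real"
  where "finite B" "B \<subseteq> V" "\<And>b. linear (\<kappa> b)" "\<And>x. x \<in> V \<Longrightarrow> (\<Sum>b\<in>B. \<kappa> b x *\<^sub>R b) = x"
proof -
  obtain A where A: "finite A" "span A = V"
    using assms by (auto simp: fin_dim_space_def)
  have V: "subspace V" using assms by (simp add: fin_dim_space_def)
  obtain B where B: "B \<subseteq> V" "independent B" "V = span B"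
    using V by (metis basis_exists span_subspace)
  have fin: "finite B"
    using independent_span_bound[OF A(1) B(2)] B(1) A(2) by auto
  define \<kappa> where
    "\<kappa> b = (SOME g :: 'a \<Rightarrow> real. linear g \<and> (\<forall>x\<in>B. g x = (if x = b then 1 else 0)))" for b
  have "linear (\<kappa> b) \<and> (\<forall>x\<in>B. \<kappa> b x = (if x = b then 1 else 0))" for b
    unfolding \<kappa>_def by (rule someI_ex[OF linear_independent_extend[OF B(2)]])
  then have \<kappa>: "linear (\<kappa> b)" "x \<in> B \<Longrightarrow> \<kappa> b x = (if x = b then 1 else 0)" for b x
    by auto
  have lin: "linear (\<lambda>x. \<Sum>b\<in>B. \<kappa> b x *\<^sub>R b)"
  proof (rule linear_compose_sum, rule ballI)
    show "linear (\<lambda>x. \<kappa> b x *\<^sub>R b)" for b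
      by (rule linearI) (simp_all add: linear_add[OF \<kappa>(1)] linear_cmul[OF \<kappa>(1)] scaleR_left_distrib)
  qed
  have on_B: "(\<Sum>b\<in>B. \<kappa> b y *\<^sub>R b) = id y" if "y \<in> B" for y
  proof -
    have "(\<Sum>b\<in>B. \<kappa> b y *\<^sub>R b) = (\<Sum>b\<in>B. if y = b then b else 0)"
      using that by (intro sum.cong refl) (simp add: \<kappa>(2))
    then show ?thesis using fin that by simp
  qed
  have "(\<Sum>b\<in>B. \<kappa> b x *\<^sub>R b) = x" if "x \<in> V" for x
  proof -
    have "x \<in> span B" using that B(3) by simp
    from linear_eq_on_span[OF lin linear_id on_B this] show ?thesis by simp
  qed
  with fin B(1) \<kappa>(1) show thesis by (rule that)
qed

section \<open>Dual spaces and biduality\<close>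

lemma restr_apply [simp]: "x \<in> S \<Longrightarrow> restr S f x = f x"
  by (simp add: restr_def)

lemma restr_outside [simp]: "x \<notin> S \<Longrightarrow> restr S f x = 0"
  by (simp add: restr_def)

lemma dualD:
  assumes "\<alpha> \<in> dual V"
  shows "linear_on V \<alpha>" "\<And>x. x \<notin> V \<Longrightarrow> \<alpha> x = 0"
  using assms by (auto simp: dual_def)

lemma dual_eqI:
  assumes "\<alpha> \<in> dual V" "\<beta> \<in> dual V" "\<And>x. x \<in> V \<Longrightarrow> \<alpha> x = \<beta> x"
  shows "\<alpha> = \<beta>"
proof
  fix x
  show "\<alpha> x = \<beta> x" using assms(3) dualD(2)[OF assms(1)] dualD(2)[OF assms(2)] by (cases "x \<in> V") auto
qed

lemma restr_in_dual:
  assumes "subspace V" "linear_on V f"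
  shows "restr V f \<in> dual V"
  using assms by (auto simp: dual_def linear_on_def subspace_add subspace_scale)

lemma linear_imp_linear_on: "linear f \<Longrightarrow> linear_on V f"
  by (simp add: linear_on_def linear_add linear_cmul)

lemma subspace_dual:
  assumes "subspace V"
  shows "subspace (dual V)"
  using assms unfolding subspace_def dual_def linear_on_def
  by (auto simp: algebra_simps)

lemma sum_fun_apply: "(\<Sum>a\<in>A. f a) x = (\<Sum>a\<in>A. f a x)"
  by (induction A rule: infinite_finite_induct) auto

text \<open>Applying \<alpha> to the coordinate expansion of a vector writes \<alpha> in the
  coordinate functionals. They therefore span the dual, which makes it finite-dimensional.\<close>

lemma dual_expansion:
  fixes \<kappa> :: "'a::real_vector \<Rightarrow> 'a \<Rightarrow> real"
  assumes V: "subspace V" and B: "finite B" "B \<subseteq> V"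
    and \<kappa>: "\<And>b. linear (\<kappa> b)" "\<And>x. x \<in> V \<Longrightarrow> (\<Sum>b\<in>B. \<kappa> b x *\<^sub>R b) = x"
    and \<alpha>: "\<alpha> \<in> dual V"
  shows "\<alpha> = (\<Sum>b\<in>B. \<alpha> b *\<^sub>R restr V (\<kappa> b))"
proof
  fix x
  show "\<alpha> x = (\<Sum>b\<in>B. \<alpha> b *\<^sub>R restr V (\<kappa> b)) x"
  proof (cases "x \<in> V")
    case True
    have "\<alpha> x = \<alpha> (\<Sum>b\<in>B. \<kappa> b x *\<^sub>R b)" using \<kappa>(2)[OF True] by simp
    also have "\<dots> = (\<Sum>b\<in>B. \<kappa> b x *\<^sub>R \<alpha> b)"
      by (rule linear_on_sum[OF dualD(1)[OF \<alpha>] V B(1)]) (use B in auto)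
    finally show ?thesis using True by (simp add: sum_fun_apply mult.commute)
  next
    case False
    then show ?thesis using dualD(2)[OF \<alpha>] by (simp add: sum_fun_apply)
  qed
qed

lemma fin_dim_space_dual:
  assumes "fin_dim_space V"
  shows "fin_dim_space (dual V)"
proof -
  have V: "subspace V" using assms by (simp add: fin_dim_space_def)
  obtain B \<kappa> where B: "finite B" "B \<subseteq> V"
    and \<kappa>: "\<And>b. linear (\<kappa> b :: _ \<Rightarrow> real)" "\<And>x. x \<in> V \<Longrightarrow> (\<Sum>b\<in>B. \<kappa> b x *\<^sub>R b) = x"
    using fin_dim_space_coordinates[OF assms] by metis
  let ?K = "(\<lambda>b. restr V (\<kappa> b)) ` B"
  have "?K \<subseteq> dual V"
    using restr_in_dual[OF V linear_imp_linear_on[OF \<kappa>(1)]] by blast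
  then have "span ?K \<subseteq> dual V"
    using span_minimal subspace_dual[OF V] by blast
  moreover have "\<alpha> \<in> span ?K" if "\<alpha> \<in> dual V" for \<alpha>
  proof -
    have "(\<Sum>b\<in>B. \<alpha> b *\<^sub>R restr V (\<kappa> b)) \<in> span ?K"
      by (intro span_sum span_scale span_base imageI)
    then show ?thesis by (simp only: dual_expansion[OF V B \<kappa> that, symmetric])
  qed
  ultimately have "span ?K = dual V" by blast
  then show ?thesis using B(1) subspace_dual[OF V] unfolding fin_dim_space_def by blast
qed

text \<open>Biduality for a subspace of the dual: extend \<open>y\<close> linearly beyond
  \<open>S\<close>, then represent the extension by a vector. This yields the surjectivity of the
  restriction map in part (I).\<close>

lemma dual_of_dual_subspace_eval:
  assumes "fin_dim_space V" "subspace S" "S \<subseteq> dual V" "y \<in> dual S"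
  obtains \<eta> where "\<eta> \<in> V" "y = restr S (ev V \<eta>)"
proof -
  have V: "subspace V" using assms by (simp add: fin_dim_space_def)
  obtain B \<kappa> where B: "finite B" "B \<subseteq> V"
    and \<kappa>: "\<And>b. linear (\<kappa> b :: _ \<Rightarrow> real)" "\<And>x. x \<in> V \<Longrightarrow> (\<Sum>b\<in>B. \<kappa> b x *\<^sub>R b) = x"
    using fin_dim_space_coordinates[OF assms(1)] by metis
  obtain Y where Y: "linear Y" "\<And>\<alpha>. \<alpha> \<in> S \<Longrightarrow> Y \<alpha> = y \<alpha>"
    using linear_on_extend[OF assms(2) dualD(1)[OF assms(4)]] by blast
  \<comment> \<open>The coefficient at \<open>b\<close> is the value of \<open>Y\<close> at the
    coordinate functional of \<open>b\<close>, so the expansion of \<alpha> in these functionals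
    gives \<open>Y\<close> \<alpha> = \<alpha> \<eta>.\<close>
  define \<eta> where "\<eta> = (\<Sum>b\<in>B. Y (restr V (\<kappa> b)) *\<^sub>R b)"
  have "\<eta> \<in> V" unfolding \<eta>_def using B V by (auto intro!: subspace_sum subspace_scale)
  moreover have "y = restr S (ev V \<eta>)"
  proof
    fix \<alpha>
    show "y \<alpha> = restr S (ev V \<eta>) \<alpha>"
    proof (cases "\<alpha> \<in> S")
      case True
      then have \<alpha>: "\<alpha> \<in> dual V" using assms by auto
      have "y \<alpha> = Y (\<Sum>b\<in>B. \<alpha> b *\<^sub>R restr V (\<kappa> b))"
        by (simp only: Y(2)[OF True] dual_expansion[OF V B \<kappa> \<alpha>, symmetric])
      also have "\<dots> = (\<Sum>b\<in>B. \<alpha> b * Y (restr V (\<kappa> b)))"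
        by (simp add: linear_sum[OF Y(1)] linear_cmul[OF Y(1)])
      also have "\<dots> = (\<Sum>b\<in>B. Y (restr V (\<kappa> b)) *\<^sub>R \<alpha> b)"
        by (simp add: mult.commute)
      also have "\<dots> = \<alpha> \<eta>"
        unfolding \<eta>_def
        by (rule linear_on_sum[OF dualD(1)[OF \<alpha>] V B(1), symmetric]) (use B in auto)
      finally show ?thesis using True \<alpha> by (simp add: ev_def)
    qed (simp add: dualD(2)[OF assms(4)])
  qed
  ultimately show thesis using that by blast
qed

section \<open>The topology of a finite-dimensional space\<close>

lemma topspace_fin_dim_topology [simp]:
  assumes "subspace V"
  shows "topspace (fin_dim_topology V) = V"
proof -
  \<comment> \<open>The zero functional exhibits \<open>V\<close> itself as a member of the
    generating family.\<close>
  have "(\<lambda>_. 0) \<in> dual V" by (simp add: dual_def linear_on_def)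
  then have "V \<in> {{x \<in> V. \<alpha> x \<in> U} | \<alpha> U. \<alpha> \<in> dual V \<and> open U}"
    by (intro CollectI exI[of _ "\<lambda>_. 0"] exI[of _ UNIV]) auto
  then show ?thesis
    unfolding fin_dim_topology_def topology_generated_by_topspace by blast
qed

lemma continuous_map_linear_on:
  assumes V: "subspace V" and f: "linear_on V f"
  shows "continuous_map (fin_dim_topology V) euclideanreal f"
proof -
  have "openin (fin_dim_topology V) {x \<in> V. f x \<in> U}" if "open U" for U
  proof -
    \<comment> \<open>The map \<open>f\<close> may be nonzero outside \<open>V\<close>; only its
      restriction belongs to \<open>dual V\<close> and so defines a generator of the
      topology.\<close>
    have "{x \<in> V. f x \<in> U} = {x \<in> V. restr V f x \<in> U}" by auto
    then show ?thesis
      unfolding fin_dim_topology_def using restr_in_dual[OF V f] that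
      by (intro topology_generated_by_Basis) blast
  qed
  then show ?thesis using V by (simp add: continuous_map_def)
qed

text \<open>The universal property of an initial topology: continuity need only be tested on the
  generating preimages of open sets under functionals.\<close>

lemma continuous_map_into_fin_dim_topology:
  assumes V: "subspace V" and f: "f \<in> topspace X \<rightarrow> V"
    and cont: "\<And>\<alpha>. \<alpha> \<in> dual V \<Longrightarrow> continuous_map X euclideanreal (\<lambda>x. \<alpha> (f x))"
  shows "continuous_map X (fin_dim_topology V) f"
  unfolding fin_dim_topology_def
proof (rule continuous_on_generated_topo)
  fix U assume "U \<in> {{x \<in> V. \<alpha> x \<in> U} | \<alpha> U. \<alpha> \<in> dual V \<and> open U}"
  then obtain \<alpha> T where U: "U = {x \<in> V. \<alpha> x \<in> T}" "\<alpha> \<in> dual V" "open T" by auto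
  have "f -` U \<inter> topspace X = {x \<in> topspace X. \<alpha> (f x) \<in> T}"
    using f U by auto
  then show "openin X (f -` U \<inter> topspace X)"
    using cont[OF U(2)] U(3) by (simp add: continuous_map_def)
next
  show "f ` topspace X \<subseteq> \<Union> {{x \<in> V. \<alpha> x \<in> U} | \<alpha> U. \<alpha> \<in> dual V \<and> open U}"
    using f topspace_fin_dim_topology[OF V]
    unfolding fin_dim_topology_def topology_generated_by_topspace by auto
qed

lemma linear_on_compose:
  assumes "linear_on V f" "f \<in> V \<rightarrow> W" "linear_on W g"
  shows "linear_on V (\<lambda>x. g (f x))"
  using assms by (auto simp: linear_on_def Pi_iff)

lemma continuous_map_fin_dim_topology_linear:
  assumes "subspace V" "subspace W" "linear_on V f" "f \<in> V \<rightarrow> W"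
  shows "continuous_map (fin_dim_topology V) (fin_dim_topology W) f"
proof (rule continuous_map_into_fin_dim_topology[OF assms(2)])
  show "f \<in> topspace (fin_dim_topology V) \<rightarrow> W" using assms(1,4) by simp
  show "continuous_map (fin_dim_topology V) euclideanreal (\<lambda>x. \<alpha> (f x))" if "\<alpha> \<in> dual W" for \<alpha>
    by (rule continuous_map_linear_on[OF assms(1) linear_on_compose[OF assms(3,4) dualD(1)[OF that]]])
qed

text \<open>By the coordinate expansion, distinct vectors differ in some coordinate, and that
  continuous functional separates them by disjoint open sets. Compact images are closed for this
  reason.\<close>

lemma Hausdorff_fin_dim_topology:
  assumes "fin_dim_space V"
  shows "Hausdorff_space (fin_dim_topology V)"
  unfolding Hausdorff_space_def
proof (intro allI impI, elim conjE)
  have V: "subspace V" using assms by (simp add: fin_dim_space_def)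
  obtain B \<kappa> where
    \<kappa>: "\<And>b. linear (\<kappa> b :: _ \<Rightarrow> real)" "\<And>x. x \<in> V \<Longrightarrow> (\<Sum>b\<in>B. \<kappa> b x *\<^sub>R b) = x"
    using fin_dim_space_coordinates[OF assms] by metis
  fix x y
  assume xy: "x \<in> topspace (fin_dim_topology V)" "y \<in> topspace (fin_dim_topology V)" "x \<noteq> y"
  then have "(\<Sum>b\<in>B. \<kappa> b x *\<^sub>R b) \<noteq> (\<Sum>b\<in>B. \<kappa> b y *\<^sub>R b)"
    using \<kappa>(2) V by simp
  then obtain b where "\<kappa> b x \<noteq> \<kappa> b y"
    by (metis (no_types, lifting) sum.cong)
  then obtain S T where ST: "open S" "open T" "\<kappa> b x \<in> S" "\<kappa> b y \<in> T" "S \<inter> T = {}"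
    using hausdorff[of "\<kappa> b x" "\<kappa> b y"] by auto
  have "continuous_map (fin_dim_topology V) euclideanreal (\<kappa> b)"
    by (intro continuous_map_linear_on V linear_imp_linear_on \<kappa>)
  then have "openin (fin_dim_topology V) {z \<in> V. \<kappa> b z \<in> U}" if "open U" for U
    using that V by (auto simp: continuous_map_def)
  then show "\<exists>S T. openin (fin_dim_topology V) S \<and> openin (fin_dim_topology V) T \<and>
      x \<in> S \<and> y \<in> T \<and> disjnt S T"
    using ST xy V
    by (intro exI[of _ "{z \<in> V. \<kappa> b z \<in> S}"] exI[of _ "{z \<in> V. \<kappa> b z \<in> T}"])
      (auto simp: disjnt_iff)
qed

text \<open>A product of compact intervals is compact, and the map from coordinates to vectors is
  continuous, since each functional composed with it is a finite linear combination of projections.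
  A compact superset is enough: it is used to make closed subsets compact.\<close>

lemma compactin_coordinate_box:
  fixes \<kappa> :: "'a::real_vector \<Rightarrow> 'a \<Rightarrow> real"
  assumes V: "subspace V" and B: "finite B" "B \<subseteq> V"
    and \<kappa>: "\<And>b. linear (\<kappa> b)" "\<And>x. x \<in> V \<Longrightarrow> (\<Sum>b\<in>B. \<kappa> b x *\<^sub>R b) = x"
  shows "\<exists>K. compactin (fin_dim_topology V) K \<and> {x \<in> V. \<forall>b\<in>B. \<bar>\<kappa> b x\<bar> \<le> r} \<subseteq> K"
proof -
  let ?X = "product_topology (\<lambda>_. euclideanreal) B"
  let ?P = "B \<rightarrow>\<^sub>E {-r..r}"
  let ?\<psi> = "\<lambda>f. \<Sum>b\<in>B. f b *\<^sub>R b"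
  have cont: "continuous_map ?X (fin_dim_topology V) ?\<psi>"
  proof (rule continuous_map_into_fin_dim_topology[OF V])
    show "?\<psi> \<in> topspace ?X \<rightarrow> V"
      using B V by (auto intro!: subspace_sum subspace_scale)
    fix \<alpha> assume \<alpha>: "\<alpha> \<in> dual V"
    have "\<alpha> (?\<psi> f) = (\<Sum>b\<in>B. f b *\<^sub>R \<alpha> b)" for f
      by (rule linear_on_sum[OF dualD(1)[OF \<alpha>] V B(1)]) (use B in auto)
    moreover have "continuous_map ?X euclideanreal (\<lambda>f. \<Sum>b\<in>B. f b *\<^sub>R \<alpha> b)"
      using B(1) by (auto intro!: continuous_map_sum continuous_map_real_mult_right
          continuous_map_product_projection)
    ultimately show "continuous_map ?X euclideanreal (\<lambda>f. \<alpha> (?\<psi> f))" by simp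
  qed
  have "compactin ?X ?P" by (simp add: compactin_PiE)
  then have "compactin (fin_dim_topology V) (?\<psi> ` ?P)"
    using cont image_compactin by blast
  moreover have "x \<in> ?\<psi> ` ?P" if x: "x \<in> V" "\<forall>b\<in>B. \<bar>\<kappa> b x\<bar> \<le> r" for x
  proof (rule image_eqI)
    \<comment> \<open>\<open>restrict\<close> is needed because members of the extensional product
      are fixed to \<open>undefined\<close> off \<open>B\<close>.\<close>
    show "x = ?\<psi> (restrict (\<lambda>b. \<kappa> b x) B)" using \<kappa>(2)[OF x(1)] by simp
    show "restrict (\<lambda>b. \<kappa> b x) B \<in> ?P" using x(2) by (force simp: abs_le_iff)
  qed
  ultimately show ?thesis by blast
qed

section \<open>Images of truncated cones\<close>

text \<open>On the compact max-norm unit sphere of \<open>C\<close> the functional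
  \<open>lam\<close> has a positive lower bound \<open>c\<close>. By homogeneity every
  \<open>x\<close> in \<open>C\<close> has max-norm at most \<open>lam x / c\<close>, so the
  truncation is a closed subset of a coordinate box.\<close>

lemma compactin_cone_truncation:
  assumes V: "fin_dim_space V" and C: "closedin (fin_dim_topology V) C" "cone C"
    and lam: "linear_on V lam" "separates C lam"
  shows "compactin (fin_dim_topology V) {x \<in> C. lam x \<le> r}"
proof -
  let ?T = "fin_dim_topology V"
  have sV: "subspace V" using V by (simp add: fin_dim_space_def)
  have CV: "C \<subseteq> V" using closedin_subset[OF C(1)] sV by simp
  have contlam: "continuous_map ?T euclideanreal lam"
    by (rule continuous_map_linear_on[OF sV lam(1)])
  obtain B \<kappa> where B: "finite B" "B \<subseteq> V"
    and \<kappa>: "\<And>b. linear (\<kappa> b :: _ \<Rightarrow> real)" "\<And>x. x \<in> V \<Longrightarrow> (\<Sum>b\<in>B. \<kappa> b x *\<^sub>R b) = x"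
    using fin_dim_space_coordinates[OF V] by metis
  have cont\<kappa>: "continuous_map ?T euclideanreal (\<lambda>x. \<bar>\<kappa> b x\<bar>)" for b
    by (intro continuous_map_real_abs continuous_map_linear_on sV linear_imp_linear_on \<kappa>)
  \<comment> \<open>The part of the unit sphere of the maximum norm in the coordinates \<kappa> that
    lies in \<open>C\<close>.\<close>
  define Q where "Q = {x \<in> C. (\<forall>b\<in>B. \<bar>\<kappa> b x\<bar> \<le> 1) \<and> (\<exists>b\<in>B. \<bar>\<kappa> b x\<bar> = 1)}"
  have "compactin ?T Q"
  proof -
    obtain K where K: "compactin ?T K" "{x \<in> V. \<forall>b\<in>B. \<bar>\<kappa> b x\<bar> \<le> 1} \<subseteq> K"
      using compactin_coordinate_box[OF sV B \<kappa>, of 1] by auto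
    have clos: "closedin ?T {x \<in> V. \<bar>\<kappa> b x\<bar> \<in> U}" if "closed U" for b U
      using closedin_continuous_map_preimage[OF cont\<kappa>, of U b] that sV by simp
    \<comment> \<open>The extra \<open>V\<close> keeps the intersected family nonempty when
      \<open>B\<close> is empty, as \<open>closedin_Inter\<close> requires.\<close>
    have Q_eq: "Q = C \<inter> (V \<inter> \<Inter>((\<lambda>b. {x \<in> V. \<bar>\<kappa> b x\<bar> \<in> {..1}}) ` B))
        \<inter> \<Union>((\<lambda>b. {x \<in> V. \<bar>\<kappa> b x\<bar> \<in> {1}}) ` B)"
      using CV by (auto simp: Q_def)
    have cl1: "closedin ?T (V \<inter> \<Inter>((\<lambda>b. {x \<in> V. \<bar>\<kappa> b x\<bar> \<in> {..1}}) ` B))"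
    proof -
      have "V \<inter> \<Inter>((\<lambda>b. {x \<in> V. \<bar>\<kappa> b x\<bar> \<in> {..1}}) ` B)
          = \<Inter>(insert V ((\<lambda>b. {x \<in> V. \<bar>\<kappa> b x\<bar> \<in> {..1}}) ` B))" by simp
      moreover have "closedin ?T V" using closedin_topspace[of ?T] sV by simp
      ultimately show ?thesis
        using clos[OF closed_atMost[of 1]] by (simp only:) (intro closedin_Inter; blast)
    qed
    have cl2: "closedin ?T (\<Union>((\<lambda>b. {x \<in> V. \<bar>\<kappa> b x\<bar> \<in> {1}}) ` B))"
      using B(1) clos[of "{1}"] by (intro closedin_Union) auto
    have "closedin ?T Q"
      unfolding Q_eq by (intro closedin_Int C(1) cl1 cl2)
    moreover have "Q \<subseteq> K" using K(2) CV by (auto simp: Q_def)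
    ultimately show ?thesis using K(1) closed_compactin by blast
  qed
  then have "compact (lam ` Q)"
    using image_compactin[OF _ contlam] by simp
  moreover have pos: "lam x > 0" if "x \<in> Q" for x
  proof -
    have "x \<noteq> 0" using that \<kappa>(1) by (auto simp: Q_def linear_0)
    then show ?thesis using that lam(2) by (auto simp: Q_def separates_def)
  qed
  \<comment> \<open>The minimum of \<open>lam\<close> on \<open>Q\<close> is attained and positive;
    if \<open>Q\<close> is empty, any positive constant serves and 1 is taken.\<close>
  ultimately obtain c where c: "c > 0" "\<And>x. x \<in> Q \<Longrightarrow> lam x \<ge> c"
  proof (cases "Q = {}")
    case False
    then obtain q where "q \<in> Q" "\<forall>x\<in>Q. lam q \<le> lam x"
      using compact_attains_inf[OF \<open>compact (lam ` Q)\<close>] by auto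
    then show ?thesis using pos that by blast
  qed (use that[of 1] in auto)
  have bound: "\<bar>\<kappa> b x\<bar> \<le> r / c" if x: "x \<in> C" "lam x \<le> r" and b: "b \<in> B" for x b
  proof -
    \<comment> \<open>The maximum norm of \<open>x\<close>. If it is nonzero, dividing
      \<open>x\<close> by it gives a point of \<open>Q\<close>; if it is zero, the bound reduces to
      \<open>lam x\<close> being nonnegative.\<close>
    define m where "m = Max ((\<lambda>b. \<bar>\<kappa> b x\<bar>) ` B)"
    have le: "\<bar>\<kappa> b' x\<bar> \<le> m" if "b' \<in> B" for b'
      unfolding m_def using that B(1) by (intro Max_ge) auto
    have "m \<in> (\<lambda>b. \<bar>\<kappa> b x\<bar>) ` B"
      unfolding m_def using B(1) b by (intro Max_in) auto
    then obtain b0 where b0: "b0 \<in> B" "\<bar>\<kappa> b0 x\<bar> = m" by auto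
    have "m \<le> lam x / c"
    proof (cases "m = 0")
      case True
      have "lam x \<ge> 0"
      proof (cases "x = 0")
        case True
        then show ?thesis using linear_on_0[OF lam(1) sV] by simp
      next
        case False
        then show ?thesis using lam(2) x(1) by (auto simp: separates_def less_imp_le)
      qed
      then show ?thesis using True c(1) by simp
    next
      case False
      then have m: "m > 0" using b0 by auto
      have "(1 / m) *\<^sub>R x \<in> Q"
        using m le b0 x(1) C(2)
        by (auto simp: Q_def cone_def linear_cmul[OF \<kappa>(1)] abs_mult divide_simps)
      then have "c \<le> lam ((1 / m) *\<^sub>R x)" by (rule c(2))
      also have "\<dots> = (1 / m) * lam x"
        using lam(1) x(1) CV by (auto simp: linear_on_def)
      finally show ?thesis using m c(1) by (simp add: field_simps)
    qed
    also have "\<dots> \<le> r / c" using x(2) c(1) by (simp add: divide_right_mono)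
    finally show ?thesis using le[OF b] by linarith
  qed
  obtain K where K: "compactin ?T K" "{x \<in> V. \<forall>b\<in>B. \<bar>\<kappa> b x\<bar> \<le> r / c} \<subseteq> K"
    using compactin_coordinate_box[OF sV B \<kappa>, of "r / c"] by auto
  have "{x \<in> C. lam x \<le> r} = C \<inter> {x \<in> topspace ?T. lam x \<in> {..r}}"
    using CV sV by auto
  then have "closedin ?T {x \<in> C. lam x \<le> r}"
    using closedin_continuous_map_preimage[OF contlam, of "{..r}"] C(1) by auto
  moreover have "{x \<in> C. lam x \<le> r} \<subseteq> K" using K(2) bound CV by blast
  ultimately show ?thesis using K(1) closed_compactin by blast
qed

text \<open>A linear image of a closed cone need not be closed. Here the height \<open>lam\<close>
  is preserved by \<pi>, so below any height the image of \<open>C\<close> agrees with the image of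
  a compact truncation.\<close>

lemma closedin_linear_image_cone:
  assumes V: "fin_dim_space V" and W: "fin_dim_space W"
    and C: "closedin (fin_dim_topology V) C" "cone C"
    and lam: "linear_on V lam" "separates C lam"
    and lam': "linear_on W lam'"
    and \<pi>: "linear_on V \<pi>" "\<pi> \<in> V \<rightarrow> W"
    and eq: "\<And>x. x \<in> V \<Longrightarrow> lam' (\<pi> x) = lam x"
  shows "closedin (fin_dim_topology W) (\<pi> ` C)"
proof -
  let ?T = "fin_dim_topology W"
  have sV: "subspace V" and sW: "subspace W" using V W by (simp_all add: fin_dim_space_def)
  have CV: "C \<subseteq> V" using closedin_subset[OF C(1)] sV by simp
  have contlam': "continuous_map ?T euclideanreal lam'"
    by (rule continuous_map_linear_on[OF sW lam'])
  have closed_img: "closedin ?T (\<pi> ` {x \<in> C. lam x \<le> r})" for r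
    by (intro compactin_imp_closedin Hausdorff_fin_dim_topology W
        image_compactin[OF compactin_cone_truncation[OF V C lam]]
        continuous_map_fin_dim_topology_linear sV sW \<pi>)
  have "\<exists>N. openin ?T N \<and> y \<in> N \<and> N \<subseteq> W - \<pi> ` C" if y: "y \<in> W - \<pi> ` C" for y
  proof -
    \<comment> \<open>The margin 1 makes the open strip below \<open>?r\<close> a neighbourhood of
      \<open>y\<close>. A point of the image of \<open>C\<close> in the strip has a preimage of
      height below \<open>?r\<close>, so it lies in the compact image that is removed.\<close>
    let ?r = "lam' y + 1"
    let ?N = "{z \<in> topspace ?T. lam' z \<in> {..<?r}} - \<pi> ` {x \<in> C. lam x \<le> ?r}"
    have "openin ?T {z \<in> topspace ?T. lam' z \<in> {..<?r}}"
      by (rule openin_continuous_map_preimage[OF contlam']) simp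
    then have "openin ?T ?N" using closed_img by (rule openin_diff)
    moreover have "y \<in> ?N" using y sW by auto
    moreover have "?N \<subseteq> W - \<pi> ` C" using eq CV sW by force
    ultimately show ?thesis by blast
  qed
  then have "openin ?T (W - \<pi> ` C)" by (subst openin_subopen) blast
  then show ?thesis using \<pi>(2) CV sW by (auto simp: closedin_def)
qed

section \<open>Cone-pairs\<close>

text \<open>If \<open>C\<close> were {0}, its differences would give \<open>V\<close> = {0} =
  \<open>C\<close>, against \<open>C\<close> being a proper subset.\<close>

lemma regular_cone_nonzero:
  assumes "regular_cone V C" "subspace V"
  obtains x where "x \<in> C" "x \<noteq> 0"
proof -
  have "0 \<in> C" "C \<subset> V" "{x - y | x y. x \<in> C \<and> y \<in> C} = V"
    using assms by (auto simp: regular_cone_def)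
  then have "C \<noteq> {0}" by auto
  then show thesis using that \<open>0 \<in> C\<close> by blast
qed

lemma unit_plane_point:
  assumes "regular_cone V C" "subspace V" "linear_on V lam" "separates C lam"
  obtains x where "x \<in> C" "x \<in> V" "lam x = 1"
proof -
  obtain x where x: "x \<in> C" "x \<noteq> 0" using regular_cone_nonzero[OF assms(1,2)] by blast
  have pos: "lam x > 0" using x assms(4) by (simp add: separates_def)
  have C: "cone C" "C \<subseteq> V" using assms(1) by (auto simp: regular_cone_def)
  have "(1 / lam x) *\<^sub>R x \<in> C" using C(1) x(1) pos by (simp add: cone_def)
  moreover have "lam ((1 / lam x) *\<^sub>R x) = 1"
    using assms(3) x(1) C(2) pos by (auto simp: linear_on_def)
  ultimately show thesis using that C(2) by blast
qed

text \<open>Supplies the clause of part (I) that the unit plane is a translate of the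
  kernel.\<close>

lemma unit_plane_translate:
  assumes "subspace W" "linear_on W l" "w \<in> W" "l w = 1"
  shows "unit_plane W l = (\<lambda>y. w + y) ` {y \<in> W. l y = 0}"
proof (intro equalityI subsetI)
  fix z assume z: "z \<in> unit_plane W l"
  then have "z - w \<in> {y \<in> W. l y = 0}"
    using assms linear_on_diff[OF assms(2,1)] by (auto simp: unit_plane_def subspace_diff)
  then show "z \<in> (\<lambda>y. w + y) ` {y \<in> W. l y = 0}" by (rule rev_image_eqI) simp
qed (use assms in \<open>auto simp: unit_plane_def linear_on_def subspace_add\<close>)

text \<open>The core of part (I), freed from duality: surjectivity of \<pi> and the factorization of
  \<open>lam\<close> through it suffice. Properness, pointedness and closedness of the image all
  come from the height functional \<open>lam'\<close>.\<close>

lemma cone_pair_linear_image: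
  assumes V: "fin_dim_space V" and W: "fin_dim_space W" and C: "regular_cone V C"
    and lam: "lam \<in> dual V" "separates C lam" and lam': "lam' \<in> dual W"
    and \<pi>: "linear_on V \<pi>" "\<pi> ` V = W"
    and eq: "\<And>x. x \<in> V \<Longrightarrow> lam' (\<pi> x) = lam x"
  shows "cone_pair V W C (\<pi> ` C) lam lam' \<pi>"
proof -
  have sV: "subspace V" and sW: "subspace W" using V W by (simp_all add: fin_dim_space_def)
  have Cs: "cone C" "convex C" "C \<subseteq> V" "closedin (fin_dim_topology V) C"
    "{x - y | x y. x \<in> C \<and> y \<in> C} = V" "0 \<in> C"
    using C by (auto simp: regular_cone_def)
  have \<pi>W: "\<pi> \<in> V \<rightarrow> W" using \<pi>(2) by blast
  have \<pi>0: "\<pi> 0 = 0" by (rule linear_on_0[OF \<pi>(1) sV])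
  have sep: "separates (\<pi> ` C) lam'"
    unfolding separates_def
  proof (intro ballI impI)
    fix y assume "y \<in> \<pi> ` C" "y \<noteq> 0"
    then obtain x where x: "y = \<pi> x" "x \<in> C" "x \<noteq> 0" using \<pi>0 by auto
    then show "0 < lam' y" using eq lam(2) Cs(3) by (auto simp: separates_def)
  qed
  have lam'0: "lam' 0 = 0" by (rule linear_on_0[OF dualD(1)[OF lam'] sW])
  \<comment> \<open>Otherwise \<open>lam'\<close> would be positive at both \<open>y\<close> and
    \<open>- y\<close>.\<close>
  have zero: "y = 0" if y: "y \<in> \<pi> ` C" "- y \<in> \<pi> ` C" for y
  proof (rule ccontr)
    assume "y \<noteq> 0"
    then have "0 < lam' y" "0 < lam' (- y)" using sep y by (auto simp: separates_def)
    moreover have "lam' (0 - y) = lam' 0 - lam' y"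
      using y Cs(3) \<pi>W by (intro linear_on_diff[OF dualD(1)[OF lam'] sW subspace_0[OF sW]]) auto
    ultimately show False using lam'0 by simp
  qed
  moreover have "0 \<in> \<pi> ` C" using Cs(6) \<pi>0 by (metis image_eqI)
  ultimately have pointed: "\<pi> ` C \<inter> uminus ` (\<pi> ` C) = {0}" by force
  have gen: "{x - y | x y. x \<in> \<pi> ` C \<and> y \<in> \<pi> ` C} = W"
  proof -
    have diff: "\<pi> (x - y) = \<pi> x - \<pi> y" if "x \<in> C" "y \<in> C" for x y
      using linear_on_diff[OF \<pi>(1) sV] that Cs(3) by blast
    have "{x - y | x y. x \<in> \<pi> ` C \<and> y \<in> \<pi> ` C} = {\<pi> x - \<pi> y | x y. x \<in> C \<and> y \<in> C}"
      by blast
    also have "\<dots> = {\<pi> (x - y) | x y. x \<in> C \<and> y \<in> C}"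
      using diff by metis
    also have "\<dots> = \<pi> ` {x - y | x y. x \<in> C \<and> y \<in> C}" by blast
    finally show ?thesis using Cs(5) \<pi>(2) by simp
  qed
  \<comment> \<open>A point of height 1. If the image of \<open>C\<close> were all of
    \<open>W\<close>, it would contain both signs of \<pi> \<open>e\<close>, forcing \<pi>
    \<open>e\<close> = 0 although its height is 1.\<close>
  obtain e where e: "e \<in> C" "e \<in> V" "lam e = 1"
    using unit_plane_point[OF C sV dualD(1)[OF lam(1)] lam(2)] by blast
  have proper: "\<pi> ` C \<subset> W"
  proof -
    have "\<pi> ` C \<noteq> W"
    proof
      assume W': "\<pi> ` C = W"
      have "\<pi> e \<in> W" using e \<pi>W by auto
      then have "\<pi> e \<in> \<pi> ` C" "- \<pi> e \<in> \<pi> ` C"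
        using W' sW by (auto simp: subspace_neg)
      then have "\<pi> e = 0" by (rule zero)
      then show False using eq[OF e(2)] e(3) lam'0 by simp
    qed
    then show ?thesis using \<pi>W Cs(3) by blast
  qed
  have "cone (\<pi> ` C)"
    unfolding cone_def
  proof (intro ballI allI impI)
    fix y and c :: real
    assume "y \<in> \<pi> ` C" "0 \<le> c"
    then obtain x where x: "x \<in> C" "y = \<pi> x" by blast
    then have "c *\<^sub>R y = \<pi> (c *\<^sub>R x)" using \<pi>(1) Cs(3) by (auto simp: linear_on_def)
    then show "c *\<^sub>R y \<in> \<pi> ` C" using x(1) Cs(1) \<open>0 \<le> c\<close> by (simp add: cone_def)
  qed
  moreover have "convex (\<pi> ` C)"
    unfolding convex_def
  proof (intro ballI allI impI)
    fix x y and u v :: real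
    assume "x \<in> \<pi> ` C" "y \<in> \<pi> ` C" and uv: "0 \<le> u" "0 \<le> v" "u + v = 1"
    then obtain a b where ab: "a \<in> C" "b \<in> C" "x = \<pi> a" "y = \<pi> b" by auto
    have "\<pi> (u *\<^sub>R a + v *\<^sub>R b) = u *\<^sub>R x + v *\<^sub>R y"
    proof -
      have "a \<in> V" "b \<in> V" using ab Cs(3) by auto
      then show ?thesis using \<pi>(1) ab(3,4) sV by (simp add: linear_on_def subspace_scale)
    qed
    moreover have "u *\<^sub>R a + v *\<^sub>R b \<in> C" using Cs(2) ab uv by (simp add: convexD)
    ultimately show "u *\<^sub>R x + v *\<^sub>R y \<in> \<pi> ` C" by (metis image_eqI)
  qed
  moreover have "closedin (fin_dim_topology W) (\<pi> ` C)"
    using closedin_linear_image_cone[OF V W Cs(4,1) dualD(1)[OF lam(1)] lam(2)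
        dualD(1)[OF lam'] \<pi>(1) \<pi>W eq] by blast
  ultimately have reg: "regular_cone W (\<pi> ` C)"
    using proper gen pointed by (simp add: regular_cone_def)
  \<comment> \<open>Separation speaks only of nonzero vectors; at 0 linearity gives the value 0. The
    type is left general so that the fact serves both \<open>V\<close> and \<open>W\<close>.\<close>
  have nonneg: "0 \<le> l x" if "l \<in> dual U" "subspace U" "separates K l" "x \<in> K" for l U K and x :: "'z::real_vector"
    using that linear_on_0[OF dualD(1)[OF that(1)] that(2)]
    by (cases "x = 0") (auto simp: separates_def less_imp_le)
  have "lam \<in> dual_cone V C" "lam' \<in> dual_cone W (\<pi> ` C)"
    unfolding dual_cone_def
    using lam(1) lam' nonneg[OF lam(1) sV lam(2)] nonneg[OF lam' sW sep] by auto
  moreover have "\<pi> ` unit_plane V lam = unit_plane W lam'"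
  proof (intro equalityI subsetI)
    fix y assume "y \<in> unit_plane W lam'"
    then obtain x where "x \<in> V" "y = \<pi> x" "lam' y = 1" using \<pi>(2) by (auto simp: unit_plane_def)
    then show "y \<in> \<pi> ` unit_plane V lam" using eq by (auto simp: unit_plane_def)
  qed (use \<pi>W eq in \<open>auto simp: unit_plane_def\<close>)
  ultimately show ?thesis
    unfolding cone_pair_def by (intro conjI V W C reg lam(2) sep \<pi>W \<pi>(1) refl)
qed

text \<open>The definition constrains heights only on the plane \<open>lam\<close> = 1. Any vector
  can be moved into that plane along a fixed vector of height 1, and linearity then extends the
  equality to all of \<open>V\<close>.\<close>

lemma cone_pair_functional:
  assumes "cone_pair V W C D lam lam' \<pi>" "x \<in> V"
  shows "lam' (\<pi> x) = lam x"
proof -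
  have sV: "subspace V" and C: "regular_cone V C" "separates C lam"
    and lam: "linear_on V lam" and lam': "linear_on W lam'"
    and \<pi>: "linear_on V \<pi>" "\<pi> \<in> V \<rightarrow> W" and im: "\<pi> ` unit_plane V lam = unit_plane W lam'"
    using assms(1) by (auto simp: cone_pair_def fin_dim_space_def dual_cone_def dual_def)
  have lp: "linear_on V (\<lambda>x. lam' (\<pi> x))" by (rule linear_on_compose[OF \<pi> lam'])
  have one: "lam' (\<pi> z) = 1" if "z \<in> V" "lam z = 1" for z
    using im that by (auto simp: unit_plane_def)
  obtain e where e: "e \<in> V" "lam e = 1"
    using unit_plane_point[OF C(1) sV lam C(2)] by blast
  \<comment> \<open>The coefficient is chosen so that \<open>lam z\<close> = 1.\<close>
  define z where "z = x + (1 - lam x) *\<^sub>R e"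
  have split: "f z = f x + (1 - lam x) * f e" if "linear_on V f" for f :: "'a \<Rightarrow> real"
    unfolding z_def using that assms(2) e(1) sV
    by (simp add: linear_on_def subspace_scale)
  have "z \<in> V" unfolding z_def using assms(2) e(1) sV by (simp add: subspace_add subspace_scale)
  moreover have "lam z = 1" using split[OF lam] e(2) by simp
  ultimately have "1 = lam' (\<pi> x) + (1 - lam x) * 1"
    using split[OF lp] one[of z] one[OF e] by simp
  then show ?thesis by simp
qed

text \<open>\<open>D\<close> generates \<open>W\<close> and is the image of \<open>C\<close>, so
  every vector of \<open>W\<close> is a difference of two images. Injectivity of the transpose rests
  on this.\<close>

lemma cone_pair_surj:
  assumes "cone_pair V W C D lam lam' \<pi>"
  shows "\<pi> ` V = W"
proof
  have sV: "subspace V" and CV: "C \<subseteq> V" and \<pi>: "linear_on V \<pi>" "\<pi> \<in> V \<rightarrow> W" "\<pi> ` C = D"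
    and gen: "{x - y | x y. x \<in> D \<and> y \<in> D} = W"
    using assms by (auto simp: cone_pair_def fin_dim_space_def regular_cone_def)
  show "\<pi> ` V \<subseteq> W" using \<pi>(2) by blast
  show "W \<subseteq> \<pi> ` V"
  proof
    fix w assume "w \<in> W"
    then obtain a b where ab: "a \<in> C" "b \<in> C" "w = \<pi> a - \<pi> b" using gen \<pi>(3) by blast
    then have V: "a \<in> V" "b \<in> V" using CV by auto
    have "w = \<pi> (a - b)" "a - b \<in> V"
      using linear_on_diff[OF \<pi>(1) sV V] ab(3) subspace_diff[OF sV V] by simp_all
    then show "w \<in> \<pi> ` V" by blast
  qed
qed

section \<open>Restricted evaluations and the two halves of the theorem\<close>

lemma linear_on_restr_ev:
  assumes "S \<subseteq> dual V"
  shows "linear_on V (\<lambda>\<eta>. restr S (ev V \<eta>))"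
proof -
  have "linear_on V \<alpha>" if "\<alpha> \<in> S" for \<alpha> using assms that dualD(1) by blast
  then show ?thesis using assms by (auto simp: linear_on_def ev_def restr_def fun_eq_iff)
qed

lemma restr_ev_in_dual:
  assumes "subspace S" "S \<subseteq> dual V"
  shows "restr S (ev V \<eta>) \<in> dual S"
proof -
  have "linear_on S (ev V \<eta>)"
    unfolding linear_on_def
  proof (intro conjI ballI allI)
    fix \<alpha> \<beta> assume "\<alpha> \<in> S" "\<beta> \<in> S"
    moreover from this have "\<alpha> + \<beta> \<in> S" by (rule subspace_add[OF assms(1)])
    ultimately have "\<alpha> \<in> dual V" "\<beta> \<in> dual V" "\<alpha> + \<beta> \<in> dual V" using assms(2) by auto
    then show "ev V \<eta> (\<alpha> + \<beta>) = ev V \<eta> \<alpha> + ev V \<eta> \<beta>" by (simp add: ev_def)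
  next
    fix c :: real and \<alpha> assume "\<alpha> \<in> S"
    moreover from this have "c *\<^sub>R \<alpha> \<in> S" by (rule subspace_scale[OF assms(1)])
    ultimately have "\<alpha> \<in> dual V" "c *\<^sub>R \<alpha> \<in> dual V" using assms(2) by auto
    then show "ev V \<eta> (c *\<^sub>R \<alpha>) = c *\<^sub>R ev V \<eta> \<alpha>" by (simp add: ev_def)
  qed
  then show ?thesis by (rule restr_in_dual[OF assms(1)])
qed

lemma ev_in_dual_dual:
  assumes "subspace S"
  shows "ev S s \<in> dual (dual S)"
  unfolding ev_def
  by (rule restr_in_dual[OF subspace_dual[OF assms]]) (simp add: linear_on_def)

text \<open>An instance of \<open>cone_pair_linear_image\<close>: biduality makes restriction to
  \<open>S\<close> surjective, and since \<open>lam\<close> lies in \<open>S\<close>, the restricted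
  evaluation at \<eta> still takes the value \<open>lam\<close> \<eta> at
  \<open>lam\<close>.\<close>

lemma observable_restriction_cone_pair:
  fixes V :: "'v::real_vector set"
  assumes V: "fin_dim_space V" and C: "regular_cone V C"
    and lam: "lam \<in> dual V" "separates C lam"
    and S: "subspace S" "S \<subseteq> dual V" "lam \<in> S"
  shows "cone_pair V (dual S) C {restr S (ev V \<eta>) | \<eta>. \<eta> \<in> C} lam (ev S lam)
      (\<lambda>\<eta>. restr S (ev V \<eta>))"
    and "\<exists>w\<in>dual S. unit_plane (dual S) (ev S lam) = (\<lambda>y. w + y) ` {y \<in> dual S. ev S lam y = 0}"
proof -
  let ?\<pi> = "\<lambda>\<eta>. restr S (ev V \<eta>)"
  have sV: "subspace V" using V by (simp add: fin_dim_space_def)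
  have W: "fin_dim_space (dual S)"
    by (intro fin_dim_space_dual fin_dim_space_subspace[OF fin_dim_space_dual[OF V]] S)
  have \<pi>W: "?\<pi> \<eta> \<in> dual S" for \<eta> by (rule restr_ev_in_dual[OF S(1,2)])
  have surj: "?\<pi> ` V = dual S"
  proof (intro equalityI subsetI)
    fix y assume "y \<in> dual S"
    then obtain \<eta> where "\<eta> \<in> V" "y = ?\<pi> \<eta>" by (rule dual_of_dual_subspace_eval[OF V S(1,2)])
    then show "y \<in> ?\<pi> ` V" by blast
  qed (use \<pi>W in blast)
  have eq: "ev S lam (?\<pi> \<eta>) = lam \<eta>" for \<eta>
  proof -
    have "ev S lam (?\<pi> \<eta>) = ?\<pi> \<eta> lam" using \<pi>W by (simp add: ev_def[of S])
    then show ?thesis using S(3) lam(1) by (simp add: ev_def)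
  qed
  have lam': "ev S lam \<in> dual (dual S)" by (rule ev_in_dual_dual[OF S(1)])
  have "{?\<pi> \<eta> | \<eta>. \<eta> \<in> C} = ?\<pi> ` C" by blast
  then show "cone_pair V (dual S) C {?\<pi> \<eta> | \<eta>. \<eta> \<in> C} lam (ev S lam) ?\<pi>"
    using cone_pair_linear_image[OF V W C lam lam' linear_on_restr_ev[OF S(2)] surj] eq by simp
  \<comment> \<open>The image of \<open>e\<close> under restriction is the translation
    vector.\<close>
  obtain e where "lam e = 1"
    using unit_plane_point[OF C sV dualD(1)[OF lam(1)] lam(2)] by blast
  then have "ev S lam (?\<pi> e) = 1" using eq by simp
  then show "\<exists>w\<in>dual S. unit_plane (dual S) (ev S lam) = (\<lambda>y. w + y) ` {y \<in> dual S. ev S lam y = 0}"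
    by (intro bexI[OF _ \<pi>W] unit_plane_translate[OF subspace_dual[OF S(1)] dualD(1)[OF lam'] \<pi>W])
qed

text \<open>For the transpose \<tau>, surjectivity of \<pi> gives injectivity, and preservation of
  heights gives that \<open>lam'\<close> goes to \<open>lam\<close>.\<close>

lemma cone_pair_observable_restriction:
  assumes cp: "cone_pair V W C D lam lam' \<pi>"
  shows "\<exists>\<tau>. \<tau> \<in> dual W \<rightarrow> dual V \<and> linear_on (dual W) \<tau> \<and> inj_on \<tau> (dual W) \<and> \<tau> lam' = lam \<and>
    (\<forall>x\<in>V. ev W (\<pi> x) = restr (dual W) (\<lambda>a. restr (\<tau> ` dual W) (ev V x) (\<tau> a)))"
proof -
  \<comment> \<open>Cutting off outside \<open>V\<close> puts the composite into
    \<open>dual V\<close>.\<close>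
  define \<tau> where "\<tau> a = restr V (\<lambda>x. a (\<pi> x))" for a
  have sV: "subspace V" and lam: "lam \<in> dual V" and lam': "lam' \<in> dual W"
    and \<pi>: "linear_on V \<pi>" "\<pi> \<in> V \<rightarrow> W"
    using cp by (auto simp: cone_pair_def fin_dim_space_def dual_cone_def)
  have \<tau>V: "\<tau> a \<in> dual V" if "a \<in> dual W" for a
    unfolding \<tau>_def by (intro restr_in_dual sV linear_on_compose[OF \<pi> dualD(1)[OF that]])
  moreover have "linear_on (dual W) \<tau>"
    by (auto simp: linear_on_def \<tau>_def restr_def fun_eq_iff)
  moreover have "inj_on \<tau> (dual W)"
  proof (rule inj_onI)
    fix a b assume ab: "a \<in> dual W" "b \<in> dual W" "\<tau> a = \<tau> b"
    have "a (\<pi> x) = b (\<pi> x)" if "x \<in> V" for x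
      using fun_cong[OF ab(3), of x] that by (simp add: \<tau>_def)
    then show "a = b" using dual_eqI[OF ab(1,2)] cone_pair_surj[OF cp] by blast
  qed
  moreover have "\<tau> lam' = lam"
    by (rule dual_eqI[OF \<tau>V[OF lam'] lam]) (simp add: \<tau>_def cone_pair_functional[OF cp])
  moreover have "ev W (\<pi> x) = restr (dual W) (\<lambda>a. restr (\<tau> ` dual W) (ev V x) (\<tau> a))"
    if "x \<in> V" for x
  proof
    fix a
    show "ev W (\<pi> x) a = restr (dual W) (\<lambda>a. restr (\<tau> ` dual W) (ev V x) (\<tau> a)) a"
    proof (cases "a \<in> dual W")
      case True
      then have "ev V x (\<tau> a) = a (\<pi> x)"
        \<comment> \<open>Two passes: \<tau> stays folded until its membership in
          \<open>dual V\<close> has been used to evaluate \<open>ev\<close>.\<close>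
        using \<tau>V[OF True] that by (simp add: ev_def) (simp add: \<tau>_def)
      then show ?thesis using True by (simp add: ev_def[of W])
    qed (simp add: ev_def)
  qed
  ultimately show ?thesis by (intro exI[of _ \<tau>] conjI ballI) auto
qed

text \<open>In the first half \<open>S\<close> is the given space of observables, so
  \<open>W\<close> is \<open>dual S\<close>. In the second half \<open>ev W\<close> embeds
  \<open>W\<close> into its bidual, where the formula for \<pi> is stated as an equality of
  functionals on \<open>dual W\<close>.\<close>

theorem theorem3p4:
  shows
    "(\<forall>(V :: 'v::real_vector set) C lam (S :: ('v \<Rightarrow> real) set).
        fin_dim_space V \<and> regular_cone V C \<and> lam \<in> dual V \<and> separates C lam \<and>
        subspace S \<and> S \<subseteq> dual V \<and> lam \<in> S \<longrightarrow>
        (let W = dual S;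
             \<pi> = (\<lambda>\<eta>. restr S (ev V \<eta>));
             D = {restr S (ev V \<eta>) | \<eta>. \<eta> \<in> C};
             lam' = ev S lam
         in cone_pair V W C D lam lam' \<pi> \<and>
            (\<exists>w\<in>W. unit_plane W lam' = (\<lambda>y. w + y) ` {y \<in> W. lam' y = 0})))
     \<and>
     (\<forall>(V :: 'v set) (W :: 'w::real_vector set) C D lam lam' \<pi>.
        cone_pair V W C D lam lam' \<pi> \<longrightarrow>
        (\<exists>\<tau>. \<tau> \<in> dual W \<rightarrow> dual V \<and> linear_on (dual W) \<tau> \<and> inj_on \<tau> (dual W) \<and> \<tau> lam' = lam \<and>
             (\<forall>x\<in>V. ev W (\<pi> x) = restr (dual W) (\<lambda>a. restr (\<tau> ` dual W) (ev V x) (\<tau> a)))))"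
  using observable_restriction_cone_pair cone_pair_observable_restriction
  unfolding Let_def by blast

end
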